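(* The function $\eta$ is an asymmetric metric on $\mathfrak{T}_1$, that is: $\eta$ takes values in $[0,\infty)$ on $\mathfrak{T}_1\times\mathfrak{T}_1$; $\eta(X,Y)=0$ if and only if $X=Y$; $\eta(X,Y)+\eta(Y,Z)\ge \eta(X,Z)$ for all $X,Y,Z\in\mathfrak{T}_1$; and there exist $X,Y\in\mathfrak{T}_1$ with $\eta(X,Y)\neq\eta(Y,X)$. In fact, $\eta$ is the restriction to $\mathfrak{T}_1$ of the asymmetric Thompson distance $\eta_C$ of the cone $C=(\mathbb{R}_+^* )^3$.
   Context: $\mathbb{R}_+^*$ denotes the set of positive reals. Marked Euclidean triangles with edge lengths $a_1,a_2,a_3$ are parametrised by $(A_1,A_2,A_3)\in(\mathbb{R}_+^* )^3$, where $A_1=\frac{a_2+a_3-a_1}{2}$, $A_2=\frac{a_3+a_1-a_2}{2}$, $A_3=\frac{a_1+a_2-a_3}{2}$. The area is $\mathrm{Ar}(A_1,A_2,A_3)=\sqrt{(A_1+A_2+A_3)A_1A_2A_3}$. The space of unit area triangles is $\mathfrak{T}_1=\{(A_1,A_2,A_3)\in(\mathbb{R}_+^* )^3:\mathrm{Ar}(A_1,A_2,A_3)=1\}$. Define $\eta((A_1,A_2,A_3),(A_1',A_2',A_3'))=\log\max\{A_1'/A_1,A_2'/A_2,A_3'/A_3\}$. For an open convex cone $C$ in a finite-dimensional real vector space $V$ (closed under multiplication by positive scalars, with $\overline C\cap\overline{(-C)}=\{0\}$), write $v\le_C u$ if and only if $u-v\in\overline C$. The asymmetric Thompson distance on $C$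 is $\eta_C(u,v)=\log\inf\{\lambda>0: v\le_C\lambda u\}$ for $u,v\in C$. *)

theory Defs
  imports "HOL-Analysis.Analysis"
begin

text \<open>Elements of \<open>\<real>\<^sup>3\<close> are indexed by the type \<open>3\<close>, whose elements are
  \<open>1\<close>, \<open>2\<close> and \<open>3\<close> (the last one being equal to \<open>0\<close>).\<close>

definition pos_octant :: "(real ^ 3) set"
  where "pos_octant = {A. \<forall>i. 0 < A $ i}"

text \<open>A triangle with edge lengths \<open>a\<^sub>1, a\<^sub>2, a\<^sub>3\<close> is represented by the triple
  \<open>A\<^sub>1 = (a\<^sub>2 + a\<^sub>3 - a\<^sub>1) / 2\<close>, \<open>A\<^sub>2 = (a\<^sub>3 + a\<^sub>1 - a\<^sub>2) / 2\<close>, \<open>A\<^sub>3 = (a\<^sub>1 + a\<^sub>2 - a\<^sub>3) / 2\<close>;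
  the semiperimeter is \<open>A\<^sub>1 + A\<^sub>2 + A\<^sub>3\<close>, so the area below is Heron's formula.\<close>

definition triangle_area :: "real ^ 3 \<Rightarrow> real"
  where "triangle_area A = sqrt ((A $ 1 + A $ 2 + A $ 3) * A $ 1 * A $ 2 * A $ 3)"

definition unit_area_triangles :: "(real ^ 3) set"
  where "unit_area_triangles = {A \<in> pos_octant. triangle_area A = 1}"

definition eta :: "real ^ 3 \<Rightarrow> real ^ 3 \<Rightarrow> real"
  where "eta A A' = ln (Max {A' $ 1 / A $ 1, A' $ 2 / A $ 2, A' $ 3 / A $ 3})"

text \<open>The values lie in \<open>[0, \<infinity>)\<close>, and the last clause demands that \<open>d\<close> is genuinely
  not symmetric on \<open>S\<close>.\<close>

definition asymmetric_metric_on :: "'a set \<Rightarrow> ('a \<Rightarrow> 'a \<Rightarrow> real) \<Rightarrow> bool"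
  where "asymmetric_metric_on S d \<longleftrightarrow>
    (\<forall>X\<in>S. \<forall>Y\<in>S. 0 \<le> d X Y) \<and>
    (\<forall>X\<in>S. \<forall>Y\<in>S. d X Y = 0 \<longleftrightarrow> X = Y) \<and>
    (\<forall>X\<in>S. \<forall>Y\<in>S. \<forall>Z\<in>S. d X Y + d Y Z \<ge> d X Z) \<and>
    (\<exists>X\<in>S. \<exists>Y\<in>S. d X Y \<noteq> d Y X)"

text \<open>The library's \<^const>\<open>cone\<close> and \<^const>\<open>conic\<close> allow the scalar \<open>0\<close>, so they do not
  apply to open cones. The last clause excludes cones whose closure contains a line (and
  the empty set).\<close>

definition open_convex_cone :: "'v::euclidean_space set \<Rightarrow> bool"
  where "open_convex_cone C \<longleftrightarrow>
    open C \<and> convex C \<and> (\<forall>c>0. \<forall>v\<in>C. c *\<^sub>R v \<in> C) \<and>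
    closure C \<inter> closure (uminus ` C) = {0}"

definition cone_le :: "'v::euclidean_space set \<Rightarrow> 'v \<Rightarrow> 'v \<Rightarrow> bool"
  where "cone_le C v u \<longleftrightarrow> u - v \<in> closure C"

text \<open>Only meaningful for \<^term>\<open>open_convex_cone C\<close> and \<open>u, v \<in> C\<close>: the set is then nonempty
  and bounded below, as \<^const>\<open>Inf\<close> on the reals requires.\<close>

definition asymmetric_thompson :: "'v::euclidean_space set \<Rightarrow> 'v \<Rightarrow> 'v \<Rightarrow> real"
  where "asymmetric_thompson C u v = ln (Inf {l. 0 < l \<and> cone_le C v (l *\<^sub>R u)})"

end

theory Submission
  imports Defs
begin

text \<open>For \<open>X\<close> in the open octant the maximal coordinate ratio is at most \<open>l\<close> exactly when
  \<open>Y \<le> l X\<close> coordinatewise, so it is the infimum in the Thompson distance, and it is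
  submultiplicative. Heron's formula is strictly increasing in each coordinate, so two distinct
  triangles of equal area are never comparable coordinatewise; hence the ratio exceeds \<open>1\<close>.\<close>

abbreviation max_ratio :: "real ^ 3 \<Rightarrow> real ^ 3 \<Rightarrow> real"
  where "max_ratio X Y \<equiv> Max {Y $ 1 / X $ 1, Y $ 2 / X $ 2, Y $ 3 / X $ 3}"

text \<open>The denominators \<open>X $ i\<close> are positive, so they can be cleared. Used with
  \<open>l = max_ratio X Y\<close> to get a bound, with \<open>l = 1\<close> to test comparability,
  and with arbitrary \<open>l\<close> to describe the set in the Thompson distance.\<close>

lemma max_ratio_le_iff:
  assumes "X \<in> pos_octant"
  shows "max_ratio X Y \<le> l \<longleftrightarrow> (\<forall>i. Y $ i \<le> l * X $ i)"
  using assms by (simp add: pos_octant_def forall_3 divide_le_eq)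

lemma max_ratio_pos:
  assumes "X \<in> pos_octant" "Y \<in> pos_octant"
  shows "0 < max_ratio X Y"
  using assms by (simp add: pos_octant_def forall_3 less_max_iff_disj)

text \<open>Two coordinatewise dominations compose and their factors multiply; taking logarithms
  gives the triangle inequality.\<close>

lemma max_ratio_submult:
  assumes X: "X \<in> pos_octant" and Y: "Y \<in> pos_octant" and Z: "Z \<in> pos_octant"
  shows "max_ratio X Z \<le> max_ratio X Y * max_ratio Y Z"
proof -
  have "Z $ i \<le> max_ratio X Y * max_ratio Y Z * X $ i" for i
  proof -
    have "Z $ i \<le> max_ratio Y Z * Y $ i"
      using max_ratio_le_iff[OF Y, of Z "max_ratio Y Z"] by blast
    also have "\<dots> \<le> max_ratio Y Z * (max_ratio X Y * X $ i)"
      using max_ratio_le_iff[OF X, of Y "max_ratio X Y"] max_ratio_pos[OF Y Z]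
      by (intro mult_left_mono) (blast, linarith)
    finally show ?thesis by (simp add: mult_ac)
  qed
  then show ?thesis using max_ratio_le_iff[OF X] by blast
qed

lemma triangle_area_strict_mono:
  assumes X: "X \<in> pos_octant" and Y: "Y \<in> pos_octant"
    and le: "\<And>i. Y $ i \<le> X $ i" and "Y \<noteq> X"
  shows "triangle_area Y < triangle_area X"
proof -
  have pos: "0 < Y $ i" for i using Y by (simp add: pos_octant_def)
  have nonneg: "0 \<le> Y $ i" "0 \<le> X $ i" for i
    using X Y by (simp_all add: pos_octant_def less_imp_le)
  \<comment> \<open>Strictness comes from the semiperimeter alone; for the product of the
    coordinates weak monotonicity and positivity suffice.\<close>
  have sum: "Y $ 1 + Y $ 2 + Y $ 3 < X $ 1 + X $ 2 + X $ 3"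
    using \<open>Y \<noteq> X\<close> le[of 1] le[of 2] le[of 3] by (auto simp: vec_eq_iff forall_3)
  have "(Y $ 1 + Y $ 2 + Y $ 3) * (Y $ 1 * Y $ 2 * Y $ 3)
      < (X $ 1 + X $ 2 + X $ 3) * (X $ 1 * X $ 2 * X $ 3)"
  proof (rule mult_less_le_imp_less[OF sum])
    show "Y $ 1 * Y $ 2 * Y $ 3 \<le> X $ 1 * X $ 2 * X $ 3"
      using nonneg by (intro mult_mono le mult_nonneg_nonneg)
  qed (use pos[of 1] pos[of 2] pos[of 3] in auto)
  then show ?thesis by (simp add: triangle_area_def mult_ac)
qed

lemma one_less_max_ratio:
  assumes "X \<in> unit_area_triangles" "Y \<in> unit_area_triangles" "X \<noteq> Y"
  shows "1 < max_ratio X Y"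
proof -
  have pos: "X \<in> pos_octant" "Y \<in> pos_octant" and area: "triangle_area X = triangle_area Y"
    using assms by (simp_all add: unit_area_triangles_def)
  have "\<not> (\<forall>i. Y $ i \<le> X $ i)"
    using triangle_area_strict_mono[OF pos] assms(3) area by auto
  then show ?thesis
    using max_ratio_le_iff[OF pos(1), of Y 1] by (simp only: mult_1 not_le[symmetric] simp_thms)
qed

lemma closure_pos_octant: "closure pos_octant = {A. \<forall>i. 0 \<le> A $ i}"
proof
  have "closed {A :: real ^ 3. \<forall>i. 0 \<le> A $ i}"
    by (intro closed_Collect_all closed_Collect_le continuous_intros)
  then show "closure pos_octant \<subseteq> {A. \<forall>i. 0 \<le> A $ i}"
    by (intro closure_minimal) (auto simp: pos_octant_def less_imp_le)
  show "{A. \<forall>i. 0 \<le> A $ i} \<subseteq> closure pos_octant"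
  proof
    fix A :: "real ^ 3" assume A: "A \<in> {A. \<forall>i. 0 \<le> A $ i}"
    \<comment> \<open>The vector \<open>1\<close> has all coordinates equal to 1, so a small
      positive multiple of it pushes a boundary point into the open octant.\<close>
    have "(\<lambda>n. A + inverse (real (Suc n)) *\<^sub>R 1) \<longlonglongrightarrow> A + 0 *\<^sub>R 1"
      by (intro tendsto_intros LIMSEQ_inverse_real_of_nat)
    moreover have "A + inverse (real (Suc n)) *\<^sub>R 1 \<in> pos_octant" for n
      using A by (auto simp: pos_octant_def intro!: add_nonneg_pos)
    ultimately show "A \<in> closure pos_octant"
      unfolding closure_sequential
      by (intro exI[of _ "\<lambda>n. A + inverse (real (Suc n)) *\<^sub>R 1"]) simp
  qed
qed

lemma open_convex_cone_pos_octant: "open_convex_cone pos_octant"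
  unfolding open_convex_cone_def
proof (intro conjI)
  have "open {A :: real ^ 3. 0 < A $ i}" for i
    by (intro open_Collect_less continuous_intros)
  then show "open pos_octant"
    unfolding pos_octant_def Collect_all_eq by (intro open_INT) auto
  show "convex pos_octant"
  proof (rule convexI)
    fix x y :: "real ^ 3" and u v :: real
    assume *: "x \<in> pos_octant" "y \<in> pos_octant" "0 \<le> u" "0 \<le> v" "u + v = 1"
    \<comment> \<open>If \<open>u\<close> is not positive, then \<open>u = 0\<close> and
      \<open>v = 1\<close>, so the second summand is the positive one.\<close>
    then have "0 < u * x $ i + v * y $ i" for i
      by (cases "0 < u")
        (auto simp: pos_octant_def less_imp_le intro!: add_pos_nonneg mult_pos_pos mult_nonneg_nonneg)
    then show "u *\<^sub>R x + v *\<^sub>R y \<in> pos_octant" by (simp add: pos_octant_def)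
  qed
  show "\<forall>c>0. \<forall>v\<in>pos_octant. c *\<^sub>R v \<in> pos_octant"
    by (simp add: pos_octant_def)
  have "closure (uminus ` pos_octant) = uminus ` closure pos_octant"
    by (rule closure_injective_linear_image[symmetric]) (auto intro: linearI)
  also have "\<dots> = {A. - A \<in> closure pos_octant}"
    by (auto simp: image_iff) (metis minus_minus)
  \<comment> \<open>A common point satisfies \<open>0 \<le> A $ i\<close> and
    \<open>0 \<le> - A $ i\<close> for every \<open>i\<close>.\<close>
  finally show "closure pos_octant \<inter> closure (uminus ` pos_octant) = {0}"
    by (auto simp: closure_pos_octant less_eq_vec_def intro!: antisym)
qed

lemma eta_eq_asymmetric_thompson:
  assumes "X \<in> pos_octant" "Y \<in> pos_octant"
  shows "eta X Y = asymmetric_thompson pos_octant X Y"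
proof -
  have "{l. 0 < l \<and> cone_le pos_octant Y (l *\<^sub>R X)} = {l. 0 < l \<and> max_ratio X Y \<le> l}"
    unfolding max_ratio_le_iff[OF assms(1)] by (simp add: cone_le_def closure_pos_octant)
  \<comment> \<open>A positive \<open>max_ratio X Y\<close> makes every \<open>l\<close> above it
    positive, so the set is a closed half-line and its infimum is the endpoint.\<close>
  also have "\<dots> = {max_ratio X Y..}"
    using max_ratio_pos[OF assms] by (auto simp del: Max_insert intro: less_le_trans)
  finally show ?thesis
    by (simp only: asymmetric_thompson_def eta_def cInf_atLeast)
qed

lemma eta_not_symmetric:
  "\<exists>X\<in>unit_area_triangles. \<exists>Y\<in>unit_area_triangles. eta X Y \<noteq> eta Y X"
proof -
  txt \<open>The triangle with edge lengths \<open>9, 10, 17\<close> has area \<open>36\<close>; rescale it by \<open>1/6\<close> and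
    compare it with a cyclic relabelling of itself.\<close>
  define X Y :: "real ^ 3" where "X = vector [9/6, 8/6, 1/6]" and "Y = vector [8/6, 1/6, 9/6]"
  have "X \<in> unit_area_triangles" "Y \<in> unit_area_triangles"
    by (simp_all add: X_def Y_def unit_area_triangles_def pos_octant_def triangle_area_def forall_3)
  \<comment> \<open>The coordinate ratios are 8/9, 1/8, 9 in one direction and their reciprocals
    9/8, 8, 1/9 in the other.\<close>
  moreover have "max_ratio X Y = 9" "max_ratio Y X = 8"
    by (simp_all add: X_def Y_def)
  then have "eta X Y \<noteq> eta Y X" by (simp only: eta_def) simp
  ultimately show ?thesis by blast
qed

lemma asymmetric_metric_on_eta: "asymmetric_metric_on unit_area_triangles eta"
proof -
  have pos: "X \<in> pos_octant" if "X \<in> unit_area_triangles" for X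
    using that by (simp add: unit_area_triangles_def)
  have self: "eta X X = 0" if "X \<in> unit_area_triangles" for X
  proof -
    have "X $ i \<noteq> 0" for i using pos[OF that] by (simp add: pos_octant_def less_imp_neq[symmetric])
    then show ?thesis by (simp add: eta_def)
  qed
  have eta_pos: "0 < eta X Y"
    if "X \<in> unit_area_triangles" "Y \<in> unit_area_triangles" "X \<noteq> Y" for X Y
    unfolding eta_def using one_less_max_ratio[OF that] by (rule ln_gt_zero)
  \<comment> \<open>Positivity of the ratios makes the logarithm additive on their product and
    monotone.\<close>
  have "eta X Z \<le> eta X Y + eta Y Z"
    if "X \<in> pos_octant" "Y \<in> pos_octant" "Z \<in> pos_octant" for X Y Z
    unfolding eta_def
    using max_ratio_submult[OF that] max_ratio_pos that
    by (simp only: ln_mult_pos[symmetric] ln_mono)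
  then have "\<forall>X\<in>unit_area_triangles. \<forall>Y\<in>unit_area_triangles. \<forall>Z\<in>unit_area_triangles.
      eta X Z \<le> eta X Y + eta Y Z"
    using pos by blast
  moreover have "0 \<le> eta X Y \<and> (eta X Y = 0 \<longleftrightarrow> X = Y)"
    if "X \<in> unit_area_triangles" "Y \<in> unit_area_triangles" for X Y
    using self eta_pos[of X Y] that by (cases "X = Y") auto
  ultimately show ?thesis
    unfolding asymmetric_metric_on_def using eta_not_symmetric by blast
qed

theorem proposition3p2:
  shows "asymmetric_metric_on unit_area_triangles eta \<and>
    open_convex_cone pos_octant \<and>
    (\<forall>X\<in>unit_area_triangles. \<forall>Y\<in>unit_area_triangles.
       eta X Y = asymmetric_thompson pos_octant X Y)"
proof (intro conjI ballI)
  fix X Y assume "X \<in> unit_area_triangles" "Y \<in> unit_area_triangles"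
  then show "eta X Y = asymmetric_thompson pos_octant X Y"
    by (intro eta_eq_asymmetric_thompson) (simp_all add: unit_area_triangles_def)
qed (fact asymmetric_metric_on_eta open_convex_cone_pos_octant)+

end
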